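(* Let $0<\delta<1$, $0<\sigma<1$, $t>0$, $s=\sigma+it$, and define $$S_2(\sigma,t,\delta)=\sum_{m_1=[t^{1-\delta}]}^{[t]}\ \sum_{m_2=1}^{\left[\frac{m_1}{t^{1-\delta}}\right]}\frac{1}{m_1^{s}(m_1+m_2)^{\bar s}}.$$ Then $$S_2(\sigma,t,\delta)=O\left(t^{1-2\sigma+(2\sigma+1)\delta}\right),\qquad t\to\infty.$$
   Context: $[A]$ denotes the integer part of $A$, and $\bar s=\sigma-it$ is the complex conjugate of $s$. Sums over empty ranges are zero. The parameters $\sigma,\delta$ are fixed, and the $O$-statement is for real $t\to\infty$ (the implied constant may depend on $\sigma,\delta$). *)

theory Defs
  imports Complex_Main "HOL-Analysis.Analysis" "HOL-Library.Landau_Symbols"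
begin

definition S2 :: "real \<Rightarrow> real \<Rightarrow> real \<Rightarrow> complex" where
  "S2 \<sigma> t \<delta> =
    (let s = Complex \<sigma> t in
      \<Sum>m1 = nat \<lfloor>t powr (1 - \<delta>)\<rfloor>..nat \<lfloor>t\<rfloor>.
        \<Sum>m2 = 1..nat \<lfloor>real m1 / t powr (1 - \<delta>)\<rfloor>.
          1 / (of_nat m1 powr s * of_nat (m1 + m2) powr cnj s))"

end

theory Submission
  imports Defs
begin

text \<open>
  The bound follows from absolute values alone. With \<open>x = t powr (1 - \<delta>)\<close>, every summand has
  modulus at most \<open>(x / 2) powr (- 2 * \<sigma>)\<close> because \<open>m1 \<ge> \<lfloor>x\<rfloor> \<ge> x / 2\<close>, there are at most \<open>t\<close>
  values of \<open>m1\<close>, and for each at most \<open>t / x = t powr \<delta>\<close> values of \<open>m2\<close>.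
\<close>

text \<open>For a natural base the modulus of a complex power depends only on the real part of the
  exponent, which conjugation preserves. Both factors then have exponent \<open>\<sigma>\<close> and
  a base of at least \<open>y\<close>.\<close>

lemma norm_S2_summand_le:
  assumes "0 < y" "y \<le> real m" "0 \<le> \<sigma>"
  shows "norm (1 / (of_nat m powr Complex \<sigma> t * of_nat (m + k) powr cnj (Complex \<sigma> t)))
           \<le> y powr (- 2 * \<sigma>)"
proof -
  have "norm (of_nat m powr Complex \<sigma> t * of_nat (m + k) powr cnj (Complex \<sigma> t))
          = real m powr \<sigma> * real (m + k) powr \<sigma>"
    by (simp add: norm_mult norm_powr_real_powr del: of_nat_add)
  moreover have "y powr (2 * \<sigma>) \<le> real m powr \<sigma> * real (m + k) powr \<sigma>"
  proof -
    have "y powr (2 * \<sigma>) = y powr \<sigma> * y powr \<sigma>"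
      by (simp flip: powr_add)
    also have "\<dots> \<le> real m powr \<sigma> * real (m + k) powr \<sigma>"
      using assms by (intro mult_mono powr_mono2) auto
    finally show ?thesis .
  qed
  ultimately show ?thesis
    using assms(1) by (simp add: norm_divide powr_minus_divide frac_le)
qed

text \<open>Explicit form of the estimate, with a constant depending on \<open>\<sigma>\<close>
  only. The factor \<open>2 powr (2 * \<sigma>)\<close> is the price of replacing the floor of
  \<open>x\<close> by \<open>x / 2\<close>.\<close>

lemma norm_S2_le:
  assumes "0 < \<delta>" "\<delta> < 1" "0 < \<sigma>" "1 \<le> t"
  shows "norm (S2 \<sigma> t \<delta>) \<le> 2 powr (2 * \<sigma>) * t powr (1 - 2 * \<sigma> + (2 * \<sigma> + 1) * \<delta>)"
proof -
  define x where "x = t powr (1 - \<delta>)"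
  define B where "B = (x / 2) powr (- 2 * \<sigma>)"
  let ?f = "\<lambda>m k. 1 / (of_nat m powr Complex \<sigma> t * of_nat (m + k) powr cnj (Complex \<sigma> t))"
  have x: "1 \<le> x"
    using assms by (simp add: x_def ge_one_powr_ge_zero)
  have B: "0 \<le> B"
    by (simp add: B_def)
  have inner: "norm (\<Sum>k = 1..nat \<lfloor>real m / x\<rfloor>. ?f m k) \<le> t powr \<delta> * B"
    if m: "m \<in> {nat \<lfloor>x\<rfloor>..nat \<lfloor>t\<rfloor>}" for m
  proof -
    \<comment> \<open>Since \<open>x\<close> is less than its floor plus 1, and the floor is at
      least 1, \<open>x\<close> is less than twice its floor.\<close>
    have "1 \<le> \<lfloor>x\<rfloor>" "\<lfloor>x\<rfloor> \<le> int m"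
      using m x by auto
    then have lower: "x / 2 \<le> real m"
      by linarith
    have upper: "real m \<le> t"
      using m assms(4) by (simp add: le_nat_iff le_floor_iff)
    have "norm (\<Sum>k = 1..nat \<lfloor>real m / x\<rfloor>. ?f m k) \<le> real (nat \<lfloor>real m / x\<rfloor>) * B"
      using norm_S2_summand_le[of "x / 2" m \<sigma> t] lower x assms(3)
      by (intro order_trans[OF sum_norm_bound[where K = B]]) (auto simp: B_def)
    also have "\<dots> \<le> t powr \<delta> * B"
    proof (rule mult_right_mono[OF _ B])
      have "real (nat \<lfloor>real m / x\<rfloor>) \<le> real m / x"
        using x by simp
      also have "\<dots> \<le> t / x"
        using upper x by (simp add: divide_right_mono)
      also have "\<dots> = t powr \<delta>"
        using assms(4) by (simp add: x_def powr_diff)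
      finally show "real (nat \<lfloor>real m / x\<rfloor>) \<le> t powr \<delta>" .
    qed
    finally show ?thesis .
  qed
  have "norm (S2 \<sigma> t \<delta>) \<le> real (card {nat \<lfloor>x\<rfloor>..nat \<lfloor>t\<rfloor>}) * (t powr \<delta> * B)"
    unfolding S2_def Let_def x_def[symmetric] by (rule sum_norm_bound) (rule inner)
  also have "\<dots> \<le> t * (t powr \<delta> * B)"
  proof (rule mult_right_mono)
    \<comment> \<open>An interval starting at 0 would hold one index too many for the bound
      \<open>t\<close>.\<close>
    have "1 \<le> nat \<lfloor>x\<rfloor>"
      using x by linarith
    then have "card {nat \<lfloor>x\<rfloor>..nat \<lfloor>t\<rfloor>} \<le> nat \<lfloor>t\<rfloor>"
      by simp
    then show "real (card {nat \<lfloor>x\<rfloor>..nat \<lfloor>t\<rfloor>}) \<le> t"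
      using assms(4) by linarith
  qed (use B in simp)
  also have "B = 2 powr (2 * \<sigma>) * t powr (- 2 * \<sigma> * (1 - \<delta>))"
    using x assms(4)
    by (simp add: B_def x_def powr_divide powr_powr powr_minus_divide mult_ac)
  \<comment> \<open>Here \<open>\<dots>\<close> is only the new form of \<open>B\<close>. Writing
    \<open>t\<close> as \<open>t powr 1\<close> lets the exponents add up to
    \<open>1 + \<delta> - 2 * \<sigma> * (1 - \<delta>)\<close>.\<close>
  also have "t * (t powr \<delta> * \<dots>)
      = 2 powr (2 * \<sigma>) * (t powr 1 * t powr \<delta> * t powr (- 2 * \<sigma> * (1 - \<delta>)))"
    using assms(4) by simp
  also have "t powr 1 * t powr \<delta> * t powr (- 2 * \<sigma> * (1 - \<delta>))
      = t powr (1 - 2 * \<sigma> + (2 * \<sigma> + 1) * \<delta>)"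
    unfolding powr_add[symmetric] by (simp add: algebra_simps)
  finally show ?thesis .
qed

theorem theorem5p2:
  fixes \<sigma> \<delta> :: real
  assumes "0 < \<delta>" and "\<delta> < 1" and "0 < \<sigma>" and "\<sigma> < 1"
  shows "(\<lambda>t::real. S2 \<sigma> t \<delta>)
    \<in> O[at_top](\<lambda>t. complex_of_real (t powr (1 - 2 * \<sigma> + (2 * \<sigma> + 1) * \<delta>)))"
proof (rule bigoI)
  show "\<forall>\<^sub>F t in at_top. norm (S2 \<sigma> t \<delta>) \<le> 2 powr (2 * \<sigma>) *
      norm (complex_of_real (t powr (1 - 2 * \<sigma> + (2 * \<sigma> + 1) * \<delta>)))"
    using eventually_ge_at_top[of 1]
    by eventually_elim (use norm_S2_le assms in simp)
qed

end
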